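(* Let $\pi=(\pi_{ij})$ be a strictly positive probability distribution on $\{1,\dots,I_1\}\times\{1,\dots,I_2\}$, $I_1,I_2\ge2$. If the $F$-scaled interactions of type $CC$, $\gamma_{ij}(F;C,C)$, are non negative for all $i<I_1$, $j<I_2$, then the log-odds ratios of type $GG$ are all non negative.
   Context: $\phi$ is a real-valued convex function on $[0,\infty)$, differentiable on $(0,\infty)$, with $\phi(1)=\phi'(1)=0$, and $F=\phi'$ is strictly increasing on $(0,\infty)$ (so it has an inverse). For type $CC$ (continuation logits for rows and columns), with $(X_1,X_2)\sim\pi$, $i<I_1$, $j<I_2$, $u,v\in\{0,1\}$, put $E_1(i,0)=\{i\}$, $E_1(i,1)=\{i+1,\dots,I_1\}$, $E_2(j,0)=\{j\}$, $E_2(j,1)=\{j+1,\dots,I_2\}$, and $p(i,j;u,v)=P(X_1\in E_1(i,u),X_2\in E_2(j,v))$, $p_1(i;u)=P(X_1\in E_1(i,u))$, $p_2(j;v)=P(X_2\in E_2(j,v))$. With $\varrho_{ij}(u,v)=\dfrac{p(i,j;u,v)}{p_1(i;u)\,p_2(j;v)}$, the $F$-scaled interactions of type $CC$ are $$\gamma_{ij}(F;C,C)=F[\varrho_{ij}(1,1)]-F[\varrho_{ij}(1,0)]-F[\varrho_{ij}(0,1)]+F[\varrho_{ij}(0,0)].$$ Log-odds ratios of type $GG$ (global logits for both): for $i<I_1$, $j<I_2$, $$\eta_{GG}(i,j)=\log\frac{\big(\sum_{g>i,\,h>j}\pi_{gh}\big)\big(\sum_{g\le i,\,h\le j}\pi_{gh}\big)}{\big(\sum_{g\le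 i,\,h>j}\pi_{gh}\big)\big(\sum_{g>i,\,h\le j}\pi_{gh}\big)}.$$ *)

theory Defs
  imports "HOL-Probability.Probability"
begin

text \<open>
  The joint distribution of \<open>(X\<^sub>1, X\<^sub>2)\<close> is a pmf on pairs of naturals; categories of a variable with
  \<open>n\<close> levels are numbered \<open>1, \<dots>, n\<close>. The indices \<open>u, v\<close> below are meant to range over \<open>{0, 1}\<close>.
\<close>

definition cont_set :: "nat \<Rightarrow> nat \<Rightarrow> nat \<Rightarrow> nat set" where
  "cont_set n i u = (if u = 0 then {i} else {i + 1..n})"

definition joint_prob :: "(nat \<times> nat) pmf \<Rightarrow> nat \<Rightarrow> nat \<Rightarrow> nat \<Rightarrow> nat \<Rightarrow> nat \<Rightarrow> nat \<Rightarrow> real" where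
  "joint_prob \<pi> I\<^sub>1 I\<^sub>2 i j u v =
     measure_pmf.prob \<pi> {x. fst x \<in> cont_set I\<^sub>1 i u \<and> snd x \<in> cont_set I\<^sub>2 j v}"

definition row_prob :: "(nat \<times> nat) pmf \<Rightarrow> nat \<Rightarrow> nat \<Rightarrow> nat \<Rightarrow> real" where
  "row_prob \<pi> I\<^sub>1 i u = measure_pmf.prob \<pi> {x. fst x \<in> cont_set I\<^sub>1 i u}"

definition col_prob :: "(nat \<times> nat) pmf \<Rightarrow> nat \<Rightarrow> nat \<Rightarrow> nat \<Rightarrow> real" where
  "col_prob \<pi> I\<^sub>2 j v = measure_pmf.prob \<pi> {x. snd x \<in> cont_set I\<^sub>2 j v}"

definition dep_ratio :: "(nat \<times> nat) pmf \<Rightarrow> nat \<Rightarrow> nat \<Rightarrow> nat \<Rightarrow> nat \<Rightarrow> nat \<Rightarrow> nat \<Rightarrow> real" where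
  "dep_ratio \<pi> I\<^sub>1 I\<^sub>2 i j u v =
     joint_prob \<pi> I\<^sub>1 I\<^sub>2 i j u v / (row_prob \<pi> I\<^sub>1 i u * col_prob \<pi> I\<^sub>2 j v)"

definition gamma_CC ::
    "(real \<Rightarrow> real) \<Rightarrow> (nat \<times> nat) pmf \<Rightarrow> nat \<Rightarrow> nat \<Rightarrow> nat \<Rightarrow> nat \<Rightarrow> real" where
  "gamma_CC F \<pi> I\<^sub>1 I\<^sub>2 i j =
     F (dep_ratio \<pi> I\<^sub>1 I\<^sub>2 i j 1 1) - F (dep_ratio \<pi> I\<^sub>1 I\<^sub>2 i j 1 0)
     - F (dep_ratio \<pi> I\<^sub>1 I\<^sub>2 i j 0 1) + F (dep_ratio \<pi> I\<^sub>1 I\<^sub>2 i j 0 0)"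

definition eta_GG :: "(nat \<times> nat) pmf \<Rightarrow> nat \<Rightarrow> nat \<Rightarrow> nat \<Rightarrow> nat \<Rightarrow> real" where
  "eta_GG \<pi> I\<^sub>1 I\<^sub>2 i j =
     ln (((\<Sum>g=i+1..I\<^sub>1. \<Sum>h=j+1..I\<^sub>2. pmf \<pi> (g, h)) * (\<Sum>g=1..i. \<Sum>h=1..j. pmf \<pi> (g, h))) /
         ((\<Sum>g=1..i. \<Sum>h=j+1..I\<^sub>2. pmf \<pi> (g, h)) * (\<Sum>g=i+1..I\<^sub>1. \<Sum>h=1..j. pmf \<pi> (g, h))))"

end

theory Submission
  imports Defs
begin

text \<open>
  Fix \<open>j\<close>. If \<open>P(X\<^sub>1 > i | X\<^sub>2 > j) < P(X\<^sub>1 > i | X\<^sub>2 = j)\<close> for some \<open>i\<close>, then non-negativity of the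
  interaction at \<open>(i, j)\<close> and monotonicity of \<open>F\<close> force \<open>P(X\<^sub>1 = i | X\<^sub>2 > j) < P(X\<^sub>1 = i | X\<^sub>2 = j)\<close>, so
  the same strict inequality holds at \<open>i - 1\<close>; descending to \<open>i = 0\<close>, where both sides are \<open>1\<close>, is a
  contradiction. Since \<open>P(X\<^sub>1 > i | X\<^sub>2 > j - 1)\<close> is an average of \<open>P(X\<^sub>1 > i | X\<^sub>2 > j)\<close> and
  \<open>P(X\<^sub>1 > i | X\<^sub>2 = j)\<close>, the first of these is non-decreasing in \<open>j\<close> and hence at least \<open>P(X\<^sub>1 > i)\<close>.
\<close>

lemma tail_sum_le:
  fixes F :: "real \<Rightarrow> real" and r x y :: "nat \<Rightarrow> real"
  assumes F: "strict_mono_on {0<..} F"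
    and pos: "\<And>g. g \<in> {1..n} \<Longrightarrow> r g > 0 \<and> x g > 0 \<and> y g > 0"
    and total: "sum x {1..n} = sum y {1..n}"
    and interaction: "\<And>i. i \<in> {1..<n} \<Longrightarrow>
      F (sum x {i+1..n} / sum r {i+1..n}) - F (sum y {i+1..n} / sum r {i+1..n})
        - F (x i / r i) + F (y i / r i) \<ge> 0"
    and "i < n"
  shows "sum y {i+1..n} \<le> sum x {i+1..n}"
  using \<open>i < n\<close>
proof (induction i)
  case 0
  then show ?case using total by simp
next
  case (Suc k)
  define i where "i = Suc k"
  have i: "i \<in> {1..<n}" using Suc.prems by (simp add: i_def)
  \<comment> \<open>Since \<open>i < n\<close>, the tail is nonempty, so positivity is
    strict.\<close>
  have tail_pos: "sum f {i+1..n} > 0" if "\<And>g. g \<in> {1..n} \<Longrightarrow> f g > 0" for f :: "nat \<Rightarrow> real"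
    using i by (intro sum_pos) (auto intro!: that)
  have R: "sum r {i+1..n} > 0" and X: "sum x {i+1..n} > 0" and Y: "sum y {i+1..n} > 0"
    using pos by (blast intro: tail_pos)+
  have split: "sum f {k+1..n} = f i + sum f {i+1..n}" for f :: "nat \<Rightarrow> real"
    using i by (simp add: i_def sum.atLeast_Suc_atMost)
  show ?case
  proof (rule ccontr)
    assume "\<not> ?thesis"
    then have lt: "sum x {i+1..n} < sum y {i+1..n}" by (simp add: i_def)
    then have "F (sum x {i+1..n} / sum r {i+1..n}) < F (sum y {i+1..n} / sum r {i+1..n})"
      using R X Y by (intro strict_mono_onD[OF F]) (auto simp: divide_strict_right_mono)
    with interaction[OF i] have "F (x i / r i) < F (y i / r i)" by linarith
    \<comment> \<open>\<open>F\<close> is monotone only on positive reals, so both ratios must be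
      positive before \<open>F\<close> can be cancelled.\<close>
    moreover have "x i / r i > 0" "y i / r i > 0" "r i > 0" using pos[of i] i by auto
    ultimately have "x i / r i < y i / r i"
      using strict_mono_on_leD[OF F, of "y i / r i" "x i / r i"] by (force simp: not_less[symmetric])
    with \<open>r i > 0\<close> have "x i < y i" by (simp add: divide_less_cancel)
    moreover have "sum y {k+1..n} \<le> sum x {k+1..n}" using Suc by simp
    ultimately show False using lt unfolding split by linarith
  qed
qed

text \<open>Points outside the support carry no mass, so only the traces of \<open>A'\<close> and
  \<open>B'\<close> on \<open>A\<close> and \<open>B\<close> count. Either set may thus be infinite;
  taking it to be \<open>UNIV\<close> yields a marginal.\<close>

lemma pmf_prob_rectangle:
  assumes "set_pmf \<pi> \<subseteq> A \<times> B" "finite C" "finite D"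
    and "A \<inter> A' = C" "B \<inter> B' = D"
  shows "measure_pmf.prob \<pi> {x. fst x \<in> A' \<and> snd x \<in> B'} = (\<Sum>g\<in>C. \<Sum>h\<in>D. pmf \<pi> (g, h))"
proof -
  have "measure_pmf.prob \<pi> {x. fst x \<in> A' \<and> snd x \<in> B'} = measure_pmf.prob \<pi> (C \<times> D)"
    using assms by (intro measure_prob_cong_0) (auto simp: pmf_eq_0_set_pmf)
  also have "\<dots> = (\<Sum>x\<in>C \<times> D. pmf \<pi> x)"
    using assms by (intro measure_measure_pmf_finite) auto
  finally show ?thesis by (simp add: sum.cartesian_product)
qed

theorem proposition7:
  fixes \<phi> F :: "real \<Rightarrow> real"
    and \<pi> :: "(nat \<times> nat) pmf"
    and I\<^sub>1 I\<^sub>2 :: nat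
  assumes "convex_on {0..} \<phi>"
    and "\<And>x. x > 0 \<Longrightarrow> (\<phi> has_real_derivative F x) (at x)"
    and "\<phi> 1 = 0" and "F 1 = 0"
    and "strict_mono_on {0<..} F"
    and "I\<^sub>1 \<ge> 2" and "I\<^sub>2 \<ge> 2"
    and "set_pmf \<pi> = {1..I\<^sub>1} \<times> {1..I\<^sub>2}"
    and "\<And>i j. i \<in> {1..<I\<^sub>1} \<Longrightarrow> j \<in> {1..<I\<^sub>2} \<Longrightarrow> gamma_CC F \<pi> I\<^sub>1 I\<^sub>2 i j \<ge> 0"
  shows "\<forall>i\<in>{1..<I\<^sub>1}. \<forall>j\<in>{1..<I\<^sub>2}. eta_GG \<pi> I\<^sub>1 I\<^sub>2 i j \<ge> 0"
proof (intro ballI)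
  fix i j assume i: "i \<in> {1..<I\<^sub>1}" and j: "j \<in> {1..<I\<^sub>2}"
  note supp = assms(8)
  define q where "q A B = (\<Sum>g\<in>A. \<Sum>h\<in>B. pmf \<pi> (g, h))" for A B
  have prob_q: "measure_pmf.prob \<pi> {x. fst x \<in> A' \<and> snd x \<in> B'} = q A B"
    if "{1..I\<^sub>1} \<inter> A' = A" "{1..I\<^sub>2} \<inter> B' = B" for A B A' B'
    unfolding q_def using supp that by (intro pmf_prob_rectangle[of _ "{1..I\<^sub>1}" "{1..I\<^sub>2}"]) auto
  have q_pos: "q A B > 0" if "A \<subseteq> {1..I\<^sub>1}" "B \<subseteq> {1..I\<^sub>2}" "A \<noteq> {}" "B \<noteq> {}" for A B
  proof -
    have "finite A" "finite B" using that by (auto intro: finite_subset)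
    then show ?thesis
      unfolding q_def using that supp by (intro sum_pos) (auto intro!: pmf_positive)
  qed
  have q_rows: "q (A \<union> A') B = q A B + q A' B" if "finite A" "finite A'" "A \<inter> A' = {}" for A A' B
    unfolding q_def using that by (rule sum.union_disjoint)
  have q_cols: "q A (B \<union> B') = q A B + q A B'" if "finite B" "finite B'" "B \<inter> B' = {}" for A B B'
    unfolding q_def using that by (simp add: sum.union_disjoint sum.distrib)
  have q_sum: "q A B = (\<Sum>g\<in>A. q {g} B)" for A B
    by (simp add: q_def)
  have q_total: "q {1..I\<^sub>1} {1..I\<^sub>2} = 1"
    using prob_q[of UNIV "{1..I\<^sub>1}" UNIV "{1..I\<^sub>2}"] measure_pmf.prob_space[of \<pi>] by simp
  have cont: "{1..I\<^sub>1} \<inter> cont_set I\<^sub>1 a u = cont_set I\<^sub>1 a u" "{1..I\<^sub>2} \<inter> cont_set I\<^sub>2 b u = cont_set I\<^sub>2 b u"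
    if "a \<in> {1..<I\<^sub>1}" "b \<in> {1..<I\<^sub>2}" for a b u
    using that by (auto simp: cont_set_def)
  have dep: "dep_ratio \<pi> I\<^sub>1 I\<^sub>2 a b u v = q (cont_set I\<^sub>1 a u) (cont_set I\<^sub>2 b v) /
      (q (cont_set I\<^sub>1 a u) {1..I\<^sub>2} * q {1..I\<^sub>1} (cont_set I\<^sub>2 b v))"
    if "a \<in> {1..<I\<^sub>1}" "b \<in> {1..<I\<^sub>2}" for a b u v
    using prob_q[OF cont[OF that]] prob_q[of "cont_set I\<^sub>1 a u", OF cont(1)[OF that], of UNIV]
      prob_q[of UNIV, OF _ cont(2)[OF that]]
    by (simp add: dep_ratio_def joint_prob_def row_prob_def col_prob_def)

  have cond_le: "q {a+1..I\<^sub>1} {b} / q {1..I\<^sub>1} {b} \<le> q {a+1..I\<^sub>1} {b+1..I\<^sub>2} / q {1..I\<^sub>1} {b+1..I\<^sub>2}"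
    if a: "a < I\<^sub>1" and b: "b \<in> {1..<I\<^sub>2}" for a b
  proof -
    \<comment> \<open>\<open>x\<close> and \<open>y\<close> are the conditional laws of the row
      given column \<open>> b\<close> and column \<open>= b\<close>; \<open>r\<close> is the row
      marginal. Dividing their tails and point masses by those of \<open>r\<close> gives the four
      dependence ratios, so the interaction hypothesis of \<open>tail_sum_le\<close> becomes
      \<open>gamma_CC \<ge> 0\<close>.\<close>
    define r where "r g = q {g} {1..I\<^sub>2}" for g
    define x where "x g = q {g} {b+1..I\<^sub>2} / q {1..I\<^sub>1} {b+1..I\<^sub>2}" for g
    define y where "y g = q {g} {b} / q {1..I\<^sub>1} {b}" for g
    have sums: "sum r A = q A {1..I\<^sub>2}" "sum x A = q A {b+1..I\<^sub>2} / q {1..I\<^sub>1} {b+1..I\<^sub>2}"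
      "sum y A = q A {b} / q {1..I\<^sub>1} {b}" for A
      unfolding r_def x_def y_def sum_divide_distrib[symmetric] q_sum[symmetric] by (rule refl)+
    have C: "q {1..I\<^sub>1} {b+1..I\<^sub>2} > 0" "q {1..I\<^sub>1} {b} > 0"
      using a b by (auto intro!: q_pos)
    have "sum y {a+1..I\<^sub>1} \<le> sum x {a+1..I\<^sub>1}"
    proof (rule tail_sum_le[OF assms(5) _ _ _ a, of r])
      show "r g > 0 \<and> x g > 0 \<and> y g > 0" if "g \<in> {1..I\<^sub>1}" for g
        using C that b unfolding r_def x_def y_def by (auto intro!: q_pos divide_pos_pos)
      show "sum x {1..I\<^sub>1} = sum y {1..I\<^sub>1}" using C by (simp add: sums)
      show "F (sum x {k+1..I\<^sub>1} / sum r {k+1..I\<^sub>1}) - F (sum y {k+1..I\<^sub>1} / sum r {k+1..I\<^sub>1})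
          - F (x k / r k) + F (y k / r k) \<ge> 0" if k: "k \<in> {1..<I\<^sub>1}" for k
        using assms(9)[OF k b]
        by (simp add: gamma_CC_def dep[OF k b] cont_set_def sums)
           (simp add: r_def x_def y_def mult.commute)
    qed
    then show ?thesis by (simp add: sums)
  qed

  \<comment> \<open>Induction starts at \<open>b = 0\<close>, where the conditioning event is
    certain and equality holds.\<close>
  have dep_tail: "q {i+1..I\<^sub>1} {1..I\<^sub>2} \<le> q {i+1..I\<^sub>1} {b+1..I\<^sub>2} / q {1..I\<^sub>1} {b+1..I\<^sub>2}" if "b < I\<^sub>2" for b
    using that
  proof (induction b)
    case 0
    then show ?case by (simp add: q_total[simplified])
  next
    case (Suc k)
    have b: "Suc k \<in> {1..<I\<^sub>2}" using Suc.prems by simp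
    have U: "{k+1..I\<^sub>2} = {Suc k} \<union> {Suc k+1..I\<^sub>2}" using Suc.prems by auto
    have split: "q A {k+1..I\<^sub>2} = q A {Suc k} + q A {Suc k+1..I\<^sub>2}" for A
      unfolding U by (rule q_cols) auto
    have C: "q {1..I\<^sub>1} {Suc k+1..I\<^sub>2} > 0" "q {1..I\<^sub>1} {Suc k} > 0"
      using i b by (auto intro!: q_pos)
    \<comment> \<open>The left side is the mediant of the two fractions compared by
      \<open>cond_le\<close>, so it cannot exceed the larger one.\<close>
    have "q {i+1..I\<^sub>1} {k+1..I\<^sub>2} / q {1..I\<^sub>1} {k+1..I\<^sub>2}
        \<le> q {i+1..I\<^sub>1} {Suc k+1..I\<^sub>2} / q {1..I\<^sub>1} {Suc k+1..I\<^sub>2}"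
      using cond_le[of i, OF _ b] C i unfolding split
      by (simp add: field_simps)
    with Suc show ?case by (meson Suc_lessD order_trans)
  qed

  \<comment> \<open>Cutting after row \<open>i\<close> and column \<open>j\<close> leaves a 2 by 2
    table whose odds ratio is \<open>S * D / (B * C)\<close>.\<close>
  define S B C D where "S = q {i+1..I\<^sub>1} {j+1..I\<^sub>2}" and "B = q {1..i} {j+1..I\<^sub>2}"
    and "C = q {i+1..I\<^sub>1} {1..j}" and "D = q {1..i} {1..j}"
  have pos: "S > 0" "B > 0" "C > 0" "D > 0"
    using i j unfolding S_def B_def C_def D_def by (auto intro!: q_pos)
  have UI: "{1..I\<^sub>1} = {1..i} \<union> {i+1..I\<^sub>1}" and UJ: "{1..I\<^sub>2} = {1..j} \<union> {j+1..I\<^sub>2}"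
    using i j by auto
  have col: "q {1..I\<^sub>1} {j+1..I\<^sub>2} = B + S"
    unfolding UI S_def B_def by (rule q_rows) auto
  have row: "q {i+1..I\<^sub>1} {1..I\<^sub>2} = C + S"
    unfolding UJ S_def C_def by (rule q_cols) auto
  have "q {1..i} {1..I\<^sub>2} = D + B"
    unfolding UJ D_def B_def by (rule q_cols) auto
  moreover have "q {1..I\<^sub>1} {1..I\<^sub>2} = q {1..i} {1..I\<^sub>2} + q {i+1..I\<^sub>1} {1..I\<^sub>2}"
    unfolding UI by (rule q_rows) auto
  ultimately have total: "S + B + C + D = 1"
    using q_total row by simp
  \<comment> \<open>This is positive quadrant dependence at the cut. Multiplying the right side by
    the total mass 1 makes both sides quadratic, and the common terms cancel.\<close>
  have "(C + S) * (B + S) \<le> S"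
    using dep_tail[of j] j pos unfolding col row S_def[symmetric] by (simp add: pos_le_divide_eq)
  also have "S = S * (S + B + C + D)" by (simp add: total)
  finally have "B * C \<le> S * D" by (simp add: algebra_simps)
  then show "eta_GG \<pi> I\<^sub>1 I\<^sub>2 i j \<ge> 0"
    using pos unfolding eta_GG_def q_def[symmetric] S_def[symmetric] B_def[symmetric]
      C_def[symmetric] D_def[symmetric] by simp
qed

end
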